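(* For positive integers $n,k$ and a nonnegative integer $m$, let $D(n,k,m)$ be the number of partitions of $n$ into $k$ distinct parts which have exactly $m$ sequences of odd length, and let $B(n,k,m)$ be the number of partitions $\lambda$ of $n$ into odd parts with $\mathrm{Dur}_2(\lambda)=k$ and $\mathrm{alt}(\lambda)=m$. Then \[ B(n,\lceil k/2\rceil,m)=D(n,k,m). \]
   Context: For a partition into distinct parts, a "sequence" is a maximal run of parts forming consecutive integers; its length is its number of parts. For a partition $\lambda=(\lambda_1\ge\cdots\ge\lambda_\ell)$ into odd parts, with $\lambda_i=0$ for $i>\ell$, $\mathrm{Dur}_2(\lambda)=\max\{i\ge1:\lambda_i\ge 2i-1\}$ (and $0$ if $\lambda$ is empty). Alternating index: let $k=\mathrm{Dur}_2(\lambda)\ge1$. Let $\alpha$ be the partition with parts $\lambda_i-(2k-1)$ for $1\le i\le k$ (keeping only positive ones; these are even), and $\beta=(\lambda_{k+1},\lambda_{k+2},\dots,\lambda_\ell)$. Let $\alpha^*$ be the partition whose $j$-th part is $2\cdot\#\{i\le k:\lambda_i-(2k-1)\ge 2j\}$ for $j\ge1$ (nonzero ones only; this is the conjugate of the 2-modular diagram of $\alpha$). Let $\eta=\alpha^*\cup\beta$ be the partition whose multiset of parts is the multiset union of the parts of $\alpha^*$ and $\beta$, with parts written in nondecreasing order $\eta_1\le\cdots\le\eta_s$, and set $\eta_{s+1}=2k$ if $\lambda_k>2k-1$ and $\eta_{s+1}=2k-1$ if $\lambda_k=2k-1$. With $\eta_0=0$, the alternating index $\mathrm{alt}(\lambda)$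 is the number of $i\in\{1,\dots,s+1\}$ such that $\eta_i$ and $\eta_{i-1}$ have different parity. (The empty partition has $\mathrm{Dur}_2=\mathrm{alt}=0$.)
   Formalization: The formal theorem adds the assumption that k and m have the same parity; without it the identity fails, e.g. B(3,1,0)=1 because of the partition (3), while D(3,1,0)=0. For different parity D(n,k,m) is always 0. *)

theory Defs
  imports Complex_Main "HOL-Library.Multiset"
begin

text \<open>A partition is the multiset of its (positive) parts.\<close>

definition partitions :: "nat \<Rightarrow> nat multiset set" where
  "partitions n = {p. 0 \<notin># p \<and> sum_mset p = n}"

text \<open>The parts in nonincreasing order, indexed from 1 and continued by 0.\<close>

definition part :: "nat multiset \<Rightarrow> nat \<Rightarrow> nat" where
  "part p i = (if 1 \<le> i \<and> i \<le> size p
     then rev (sorted_list_of_multiset p) ! (i - 1) else 0)"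

definition distinct_parts :: "nat multiset \<Rightarrow> bool" where
  "distinct_parts p \<longleftrightarrow> (\<forall>x. count p x \<le> 1)"

definition odd_parts :: "nat multiset \<Rightarrow> bool" where
  "odd_parts p \<longleftrightarrow> (\<forall>x \<in># p. odd x)"

definition run_in :: "nat multiset \<Rightarrow> nat set \<Rightarrow> bool" where
  "run_in p R \<longleftrightarrow> (\<exists>a b. a \<le> b \<and> R = {a..b}) \<and> R \<subseteq> set_mset p"

definition sequences :: "nat multiset \<Rightarrow> nat set set" where
  "sequences p = {R. run_in p R \<and> (\<forall>R'. run_in p R' \<and> R \<subseteq> R' \<longrightarrow> R' = R)}"

definition D :: "nat \<Rightarrow> nat \<Rightarrow> nat \<Rightarrow> nat" where
  "D n k m = card {p \<in> partitions n. distinct_parts p \<and> size p = k \<and>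
     card {R \<in> sequences p. odd (card R)} = m}"

definition Dur2 :: "nat multiset \<Rightarrow> nat" where
  "Dur2 p = (if p = {#} then 0 else Max {i. 1 \<le> i \<and> 2 * i - 1 \<le> part p i})"

text \<open>
  With \<open>k = Dur2 p\<close>, the number \<open>alpha p i\<close> for \<open>1 \<le> i \<le> k\<close> is a part of \<open>\<alpha>\<close>, or 0.
  The subtraction does not truncate, since then \<open>part p i \<ge> part p k \<ge> 2 * k - 1\<close>.
\<close>

definition alpha :: "nat multiset \<Rightarrow> nat \<Rightarrow> nat" where
  "alpha p i = part p i - (2 * Dur2 p - 1)"

definition alpha_star_part :: "nat multiset \<Rightarrow> nat \<Rightarrow> nat" where
  "alpha_star_part p j = 2 * card {i \<in> {1..Dur2 p}. 2 * j \<le> alpha p i}"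

text \<open>The index set below is finite, as \<open>alpha_star_part p j = 0\<close> for \<open>2 * j > part p 1\<close>.\<close>

definition alpha_star :: "nat multiset \<Rightarrow> nat multiset" where
  "alpha_star p =
     image_mset (alpha_star_part p) (mset_set {j. 1 \<le> j \<and> alpha_star_part p j \<noteq> 0})"

definition beta :: "nat multiset \<Rightarrow> nat multiset" where
  "beta p = image_mset (part p) (mset_set {Dur2 p + 1..size p})"

definition eta_last :: "nat multiset \<Rightarrow> nat" where
  "eta_last p = (if part p (Dur2 p) > 2 * Dur2 p - 1 then 2 * Dur2 p else 2 * Dur2 p - 1)"

text \<open>The list \<open>\<eta>\<^sub>0, \<eta>\<^sub>1, \<dots>, \<eta>\<^sub>s, \<eta>\<^sub>s\<^sub>+\<^sub>1\<close>, where \<open>\<eta>\<^sub>0 = 0\<close>.\<close>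

definition eta :: "nat multiset \<Rightarrow> nat list" where
  "eta p = 0 # sorted_list_of_multiset (alpha_star p + beta p) @ [eta_last p]"

definition alt :: "nat multiset \<Rightarrow> nat" where
  "alt p = (if p = {#} then 0
     else card {i \<in> {1..<length (eta p)}. even (eta p ! i) \<noteq> even (eta p ! (i - 1))})"

text \<open>
  For a partition into \<open>k\<close> distinct parts the number of sequences of odd length has the
  parity of \<open>k\<close>, so \<open>D n k m = 0\<close> if \<open>k\<close> and \<open>m\<close> have different parity. On the
  other side \<open>Dur2\<close> does not determine the parity of \<open>alt\<close>: the counts
  \<open>B n h m\<close> with \<open>m\<close> odd correspond to \<open>k = 2 * h - 1\<close>, those with \<open>m\<close>
  even to \<open>k = 2 * h\<close>. Hence \<open>D n k m\<close> and \<open>B n \<lceil>k / 2\<rceil> m\<close> can only be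
  compared when \<open>k\<close> and \<open>m\<close> have the same parity; e.g. \<open>D 3 1 0 = 0\<close> but
  \<open>B 3 1 0 = 1\<close>, because of the partition \<open>{#3#}\<close>.
\<close>

definition B :: "nat \<Rightarrow> nat \<Rightarrow> nat \<Rightarrow> nat" where
  "B n k m = card {p \<in> partitions n. odd_parts p \<and> Dur2 p = k \<and> alt p = m}"

end

theory Submission
  imports Defs
begin

text \<open>
  Both sides count partitions with bounded parts. Subtracting the staircase \<open>K, \<dots>, 1\<close> from a
  partition into \<open>K\<close> distinct parts and conjugating yields a partition \<open>v\<close> of
  \<open>n - K (K + 1) / 2\<close> into parts at most \<open>K\<close>. The sequences end exactly at the positions in
  \<open>set_mset v \<union> {K}\<close>, so those of odd length are the parity changes in \<open>0, v, K\<close>.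
  Conversely \<open>\<lambda> \<mapsto> \<eta>\<close> is a bijection from the partitions of \<open>n\<close> into odd parts with
  \<open>Dur2 = h\<close> onto the partitions of \<open>n - h (2 h - 1)\<close> into parts at most \<open>2 h\<close>: the even parts of
  \<open>\<eta>\<close> come from \<open>\<alpha>\<^sup>*\<close> and the odd ones from \<open>\<beta>\<close>. The number of parity changes has the
  parity of the last entry, hence \<open>alt\<close> is even iff \<open>2 h\<close> is a part of \<open>\<eta>\<close>. If it is not,
  \<open>v = \<eta>\<close> with \<open>K = 2 h - 1\<close>; if it is, removing one part \<open>2 h\<close> gives \<open>v\<close> with \<open>K = 2 h\<close>.
\<close>

section \<open>Parts in nonincreasing order\<close>

lemma mset_map_upto: "mset (map f [1..<Suc L]) = image_mset f (mset_set {1..L})"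
  by (simp add: atLeastLessThanSuc_atLeastAtMost mset_upt del: upt_Suc)

lemma sorted_list_of_image_mset_upto:
  assumes "\<And>i j. 1 \<le> i \<Longrightarrow> i \<le> j \<Longrightarrow> j \<le> L \<Longrightarrow> f j \<le> (f i :: nat)"
  shows "rev (sorted_list_of_multiset (image_mset f (mset_set {1..L}))) = map f [1..<Suc L]"
proof -
  have "sorted (rev (map f [1..<Suc L]))"
    unfolding sorted_wrt_rev sorted_wrt_map
    by (rule sorted_wrt_mono_rel[OF _ strict_sorted_list_of_set[of "{1..<Suc L}", simplified sorted_list_of_set_range]])
       (use assms in auto)
  then have "sorted_list_of_multiset (image_mset f (mset_set {1..L})) = rev (map f [1..<Suc L])"
    by (metis mset_map_upto mset_rev sorted_list_of_multiset_mset sorted_sort_id)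
  then show ?thesis by simp
qed

text \<open>A nonincreasing family is already listed in the order that \<open>part\<close> uses.
  This computes the parts of multisets that are built explicitly, such as
  \<open>add_staircase\<close> and \<open>from_eta\<close>.\<close>

lemma part_image_mset_upto:
  assumes "\<And>i j. 1 \<le> i \<Longrightarrow> i \<le> j \<Longrightarrow> j \<le> L \<Longrightarrow> f j \<le> f i"
  shows "part (image_mset f (mset_set {1..L})) i = (if 1 \<le> i \<and> i \<le> L then f i else 0)"
  by (auto simp: part_def sorted_list_of_image_mset_upto[OF assms] simp del: upt_Suc One_nat_def)

lemma length_sorted_list_of_multiset [simp]: "length (sorted_list_of_multiset p) = size p"
  by (metis mset_sorted_list_of_multiset size_mset)

lemma map_part_upto: "map (part p) [1..<Suc (size p)] = rev (sorted_list_of_multiset p)"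
  by (rule nth_equalityI) (auto simp: part_def simp del: upt_Suc)

lemma image_mset_part: "image_mset (part p) (mset_set {1..size p}) = p"
  unfolding mset_map_upto[symmetric] map_part_upto by simp

lemma part_eq_0: "size p < i \<Longrightarrow> part p i = 0"
  by (simp add: part_def)

lemma part_in: "1 \<le> i \<Longrightarrow> i \<le> size p \<Longrightarrow> part p i \<in># p"
  by (subst (2) image_mset_part[symmetric]) simp

lemma part_antimono:
  assumes "1 \<le> i" "i \<le> j"
  shows "part p j \<le> part p i"
proof (cases "j \<le> size p")
  case True
  then show ?thesis
    using assms sorted_nth_mono[OF sorted_sorted_list_of_multiset, of "size p - j" "size p - i" p]
    by (auto simp: part_def rev_nth)
qed (simp add: part_eq_0)

lemma part_pos: "0 \<notin># p \<Longrightarrow> 1 \<le> i \<Longrightarrow> i \<le> size p \<Longrightarrow> part p i > 0"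
  using part_in by (metis gr0I)

lemma part_strict:
  assumes "distinct_parts p" "1 \<le> i" "i < j" "j \<le> size p"
  shows "part p j < part p i"
proof -
  have "count p x = 1" if "x \<in># p" for x
    using assms(1) that by (simp add: distinct_parts_def le_antisym Suc_le_eq)
  then have "distinct (rev (sorted_list_of_multiset p))"
    by (auto simp: distinct_count_atmost_1 not_in_iff)
  then have "part p i \<noteq> part p j"
    using assms by (auto simp: part_def nth_eq_iff_index_eq)
  then show ?thesis
    using part_antimono[of i j p] assms by auto
qed

section \<open>Parity changes\<close>

text \<open>The inserted 0 plays the role of \<open>\<eta>\<^sub>0\<close> and keeps
  \<open>Max\<close> away from the empty set.\<close>

definition pred_in :: "nat set \<Rightarrow> nat \<Rightarrow> nat" where
  "pred_in S x = Max (insert 0 {y \<in> S. y < x})"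

text \<open>A set suffices, because repeated entries of a sorted list create no parity change. As
  \<open>pred_in S x\<close> never exceeds \<open>x\<close>, an odd difference means different
  parity.\<close>

definition parity_changes :: "nat set \<Rightarrow> nat" where
  "parity_changes S = card {x \<in> S. odd (x - pred_in S x)}"

lemma finite_below [simp]: "finite {y \<in> S. y < (x::nat)}"
  by (rule finite_subset[of _ "{..<x}"]) auto

lemma pred_in_cases: "pred_in S x = 0 \<or> pred_in S x \<in> S \<and> pred_in S x < x"
  using Max_in[of "insert 0 {y \<in> S. y < x}"] by (auto simp: pred_in_def)

lemma pred_in_less: "0 < x \<Longrightarrow> pred_in S x < x"
  using pred_in_cases[of S x] by auto

lemma pred_in_ge: "y \<in> S \<Longrightarrow> y < x \<Longrightarrow> y \<le> pred_in S x"
  by (simp add: pred_in_def)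

definition list_changes :: "nat list \<Rightarrow> nat" where
  "list_changes l = card {i \<in> {1..<length l}. even (l ! i) \<noteq> even (l ! (i - 1))}"

lemma list_changes_snoc:
  assumes "l \<noteq> []"
  shows "list_changes (l @ [z]) = list_changes l + (if even z \<noteq> even (last l) then 1 else 0)"
proof -
  let ?P = "\<lambda>l i. even (l ! i) \<noteq> even (l ! (i - 1))"
  have "{i \<in> {1..<length (l @ [z])}. ?P (l @ [z]) i}
      = {i \<in> {1..<length l}. ?P l i} \<union> (if even z \<noteq> even (last l) then {length l} else {})"
    (is "?A = ?B \<union> ?C")
    using assms by (auto simp: nth_append last_conv_nth less_Suc_eq)
  moreover have "card (?B \<union> ?C) = card ?B + card ?C"
    by (rule card_Un_disjoint) auto
  ultimately show ?thesis
    by (simp add: list_changes_def)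
qed

lemma sorted_le_last: "sorted l \<Longrightarrow> y \<in> set l \<Longrightarrow> y \<le> last l"
  by (cases l rule: rev_cases) (auto simp: sorted_append)

text \<open>Appending an entry equal to the last one changes neither side. A strictly larger entry
  leaves all earlier predecessors alone, and its own predecessor is the old last entry, or
  0.\<close>

lemma list_changes_sorted:
  "sorted l \<Longrightarrow> list_changes (0 # l) = parity_changes (set l)"
proof (induction l rule: rev_induct)
  case Nil
  then show ?case by (simp add: list_changes_def parity_changes_def)
next
  case (snoc z l)
  then have sl: "sorted l" and le: "\<And>y. y \<in> set l \<Longrightarrow> y \<le> z"
    by (auto simp: sorted_append)
  have eq: "list_changes (0 # l @ [z]) = parity_changes (set l) + (if even z \<noteq> even (last (0 # l)) then 1 else 0)"
    using list_changes_snoc[of "0 # l" z] snoc.IH sl by simp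
  show ?case
  proof (cases "z \<in> set l")
    case True
    then have "last l = z"
      using sorted_le_last[OF sl] le last_in_set by (metis empty_iff empty_set le_antisym)
    then show ?thesis
      using eq True by (auto simp: insert_absorb)
  next
    case False
    then have lt: "\<And>y. y \<in> set l \<Longrightarrow> y < z"
      using le le_neq_implies_less by blast
    have last: "pred_in (set (l @ [z])) z = last (0 # l)"
    proof (cases "l = []")
      case False
      then have "y \<le> last l" if "y \<in> set l" for y
        using sorted_le_last[OF sl that] by simp
      then show ?thesis
        using False lt by (auto simp: pred_in_def intro!: Max_eqI)
    qed (auto simp: pred_in_def intro: Max_eqI)
    have "pred_in (set (l @ [z])) x = pred_in (set l) x" if "x \<in> set l" for x
      using lt[OF that] unfolding pred_in_def by (intro arg_cong[of _ _ Max]) auto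
    then have "{x \<in> set (l @ [z]). odd (x - pred_in (set (l @ [z])) x)}
       = {x \<in> set l. odd (x - pred_in (set l) x)} \<union> (if odd (z - last (0 # l)) then {z} else {})"
      using last by auto
    moreover have "odd (z - last (0 # l)) \<longleftrightarrow> even z \<noteq> even (last (0 # l))"
      using le[of "last l"] by (auto simp: even_diff_nat)
    ultimately show ?thesis
      using eq False by (auto simp: parity_changes_def)
  qed
qed

text \<open>Every change flips the parity, starting from the even entry 0. This is what ties the
  parity of \<open>alt\<close> to the last entry of \<open>eta\<close>.\<close>

lemma even_list_changes: "even (list_changes (0 # l)) \<longleftrightarrow> even (last (0 # l))"
proof (induction l rule: rev_induct)
  case Nil
  then show ?case by (simp add: list_changes_def)
next
  case (snoc z l)
  then show ?case using list_changes_snoc[of "0 # l" z] by auto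
qed

section \<open>Weights expressed by multiplicities and tail sums\<close>

lemma sum_mset_conv_count:
  assumes "set_mset v \<subseteq> {1..K}"
  shows "sum_mset v = (\<Sum>j = 1..K. j * count v j)"
  using assms
proof (induction v)
  case (add x v)
  have "(\<Sum>j = 1..K. j * count (add_mset x v) j) = (\<Sum>j = 1..K. (if j = x then x else 0) + j * count v j)"
    by (rule sum.cong) auto
  also have "\<dots> = x + (\<Sum>j = 1..K. j * count v j)"
    using add.prems by (simp add: sum.distrib)
  finally show ?case using add by simp
qed simp

text \<open>Interchanging the sums, the term \<open>h j\<close> occurs once for each
  \<open>i\<close> from 1 to \<open>j\<close>.\<close>

lemma sum_tails:
  "(\<Sum>i = 1..K. \<Sum>j = i..K. (h j :: nat)) = (\<Sum>j = 1..K. j * h j)"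
proof (induction K)
  case (Suc K)
  have "(\<Sum>i = 1..Suc K. \<Sum>j = i..Suc K. h j) = (\<Sum>i = 1..K. (\<Sum>j = i..K. h j) + h (Suc K)) + h (Suc K)"
    by simp
  then show ?case using Suc by (simp add: sum.distrib)
qed simp

section \<open>Partitions into distinct parts\<close>

text \<open>\<open>T\<close> holds the positions after which the decreasing list
  \<open>f 1, ..., f K\<close> breaks off. It cuts the positions into blocks of consecutive values,
  and the block that ends at \<open>i\<close> has length \<open>i - pred_in T i\<close>.\<close>

lemma card_odd_sequences:
  fixes f :: "nat \<Rightarrow> nat"
  assumes p: "set_mset p = f ` {1..K}"
    and T: "T \<subseteq> {1..K}" "K \<in> T"
    and gap: "\<And>i. i \<in> T \<Longrightarrow> i < K \<Longrightarrow> f (Suc i) + 1 < f i"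
    and step: "\<And>i. i \<in> {1..K} - T \<Longrightarrow> f i = f (Suc i) + 1"
  shows "card {R \<in> sequences p. odd (card R)} = parity_changes T"
proof -
  \<comment> \<open>Since \<open>f\<close> decreases, the last position of a block carries its least
    value. The default 0 of \<open>pred_in\<close> makes the first block start at position
    1.\<close>
  define block where "block i = {f i..f (Suc (pred_in T i))}" for i
  have dec1: "f (Suc i) < f i" if "1 \<le> i" "i < K" for i
    using gap[of i] step[of i] that by (cases "i \<in> T") auto
  have dec: "f j < f i" if "i < j" "1 \<le> i" "j \<le> K" for i j
    using that
  proof (induction rule: less_Suc_induct)
    case (1 i)
    then show ?case using dec1 by simp
  next
    case (2 i j k)
    then show ?case by fastforce
  qed
  have dec_le: "f j \<le> f i" if "i \<le> j" "1 \<le> i" "j \<le> K" for i j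
    using dec[of i j] that by (cases "i = j") auto
  have inside: "f j = f i + (i - j)" if "i \<in> T" "pred_in T i < j" "j \<le> i" for i j
    using that(3,2)
  proof (induction rule: inc_induct)
    case (step j)
    then have "j \<notin> T" "j \<in> {1..K}"
      using pred_in_ge[of j T i] T(1) \<open>i \<in> T\<close> by (auto simp: not_le[symmetric])
    then show ?case
      using assms(5)[of j] step by auto
  qed simp
  have pre_lt: "pred_in T i < i" if "i \<in> T" for i
    using that T(1) by (intro pred_in_less) auto
  have block_card: "card (block i) = i - pred_in T i" if "i \<in> T" for i
    using inside[OF that, of "Suc (pred_in T i)"] pre_lt[OF that] by (simp add: block_def)
  have block_sub: "block i \<subseteq> f ` {1..K}" if i: "i \<in> T" for i
  proof
    fix x assume "x \<in> block i"
    then have "x = f (i - (x - f i))" "i - (x - f i) \<in> {1..K}"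
      using inside[OF i, of "Suc (pred_in T i)"] inside[OF i, of "i - (x - f i)"] pre_lt[OF i] T(1) i
      by (auto simp: block_def)
    then show "x \<in> f ` {1..K}" by blast
  qed
  have block_run: "run_in p (block i)" if "i \<in> T" for i
    using block_sub[OF that] inside[OF that, of "Suc (pred_in T i)"] pre_lt[OF that]
    unfolding run_in_def p block_def by (metis Suc_leI le_add1 lessI)
  have block_max: "{a..b} = block i" if i: "i \<in> T" and ab: "{a..b} \<subseteq> f ` {1..K}" "block i \<subseteq> {a..b}" for i a b
  proof -
    let ?s = "pred_in T i"
    have ne: "f i \<le> f (Suc ?s)"
      using inside[OF i, of "Suc ?s"] pre_lt[OF i] by simp
    then have le: "a \<le> f i" "f (Suc ?s) \<le> b"
      using ab(2) by (auto simp: block_def)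
    \<comment> \<open>Going lower needs the value \<open>f i - 1\<close> at a position beyond
      \<open>i\<close>, which the gap after \<open>i\<close> excludes.\<close>
    have "\<not> a < f i"
    proof
      assume "a < f i"
      then have "f i - 1 \<in> f ` {1..K}"
        using ab(1) le ne by (intro subsetD[OF ab(1)]) auto
      then obtain j where j: "j \<in> {1..K}" "f j = f i - 1" by auto
      have "i < j"
        using dec_le[of j i] j i T(1) \<open>a < f i\<close> by (force simp: not_le[symmetric])
      then have "f j \<le> f (Suc i)" "f (Suc i) + 1 < f i"
        using dec_le[of "Suc i" j] j gap[OF i] by auto
      then show False using j by simp
    qed
    \<comment> \<open>Going higher needs the value \<open>f (Suc ?s) + 1\<close> at a position up to
      \<open>?s\<close>. Then \<open>?s\<close> is nonzero, so it lies in \<open>T\<close>, and the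
      gap after it excludes this.\<close>
    moreover have "\<not> f (Suc ?s) < b"
    proof
      assume "f (Suc ?s) < b"
      then have "f (Suc ?s) + 1 \<in> f ` {1..K}"
        using le ne by (intro subsetD[OF ab(1)]) auto
      then obtain j where j: "j \<in> {1..K}" "f j = f (Suc ?s) + 1" by auto
      have K: "Suc ?s \<le> K" using pre_lt[OF i] i T(1) by fastforce
      have "j \<le> ?s"
        using dec_le[of "Suc ?s" j] j by (force simp: not_less_eq_eq[symmetric])
      moreover from this have "?s \<in> T"
        using pred_in_cases[of T i] j(1) by auto
      ultimately have "f ?s \<le> f j" "f (Suc ?s) + 1 < f ?s"
        using dec_le[of j ?s] j(1) gap[of ?s] K by auto
      then show False using j by simp
    qed
    ultimately show ?thesis using le by (simp add: block_def)
  qed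
  have block_seq: "block i \<in> sequences p" if "i \<in> T" for i
    using block_run[OF that] block_max[OF that] unfolding sequences_def run_in_def p by blast
  have "R \<in> block ` T" if R: "R \<in> sequences p" for R
  proof -
    from R obtain a b where ab: "a \<le> b" "R = {a..b}" "R \<subseteq> f ` {1..K}"
      by (auto simp: sequences_def run_in_def p)
    have max: "{c..d} = R" if "R \<subseteq> {c..d}" "{c..d} \<subseteq> f ` {1..K}" for c d
    proof -
      have "run_in p {c..d}"
        using that ab unfolding run_in_def p by (metis atLeastatMost_empty_iff atLeastatMost_subset_iff order_trans)
      then show ?thesis using R that by (auto simp: sequences_def)
    qed
    from ab obtain i where i: "i \<in> {1..K}" "a = f i" by auto
    \<comment> \<open>Otherwise \<open>f (Suc i)\<close> is \<open>a - 1\<close> and prolongs the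
      maximal run \<open>R\<close>.\<close>
    have "i \<in> T"
    proof (rule ccontr)
      assume "i \<notin> T"
      then have a: "a = f (Suc i) + 1" and "Suc i \<in> {1..K}"
        using step[of i] i T(2) by (auto simp: Suc_le_eq le_less)
      then have "f (Suc i) \<in> f ` {1..K}" by blast
      moreover have "{f (Suc i)..b} = insert (f (Suc i)) R"
        using ab a by auto
      ultimately have "{f (Suc i)..b} = R"
        using ab by (intro max) auto
      then show False using ab a by auto
    qed
    \<comment> \<open>\<open>R\<close> and \<open>block i\<close> share their lower end, so their
      union is again an interval; both are maximal, so both equal it.\<close>
    define d where "d = max b (f (Suc (pred_in T i)))"
    have "{a..d} = R \<union> block i"
      using i ab by (auto simp: d_def block_def)
    then have "{a..d} = block i" "{a..d} = R"
      using block_max[OF \<open>i \<in> T\<close>, of a d] max[of a d] ab block_sub[OF \<open>i \<in> T\<close>] by auto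
    then show ?thesis using \<open>i \<in> T\<close> by auto
  qed
  then have seq: "sequences p = block ` T" using block_seq by blast
  have "inj_on block T"
  proof (rule inj_onI)
    fix i j assume ij: "i \<in> T" "j \<in> T" "block i = block j"
    then have "f i = f j"
      using inside[of i "Suc (pred_in T i)"] inside[of j "Suc (pred_in T j)"]
        pre_lt[OF ij(1)] pre_lt[OF ij(2)]
      by (auto simp: block_def Icc_eq_Icc)
    then show "i = j"
      using dec[of i j] dec[of j i] ij T(1) by (cases i j rule: linorder_cases) fastforce+
  qed
  moreover have "{R \<in> sequences p. odd (card R)} = block ` {i \<in> T. odd (i - pred_in T i)}"
    using block_card by (auto simp: seq)
  ultimately show ?thesis
    by (metis (no_types, lifting) parity_changes_def card_image inj_on_subset mem_Collect_eq subsetI)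
qed

section \<open>The staircase bijection for distinct parts\<close>

text \<open>For \<open>v\<close> with parts at most \<open>K\<close> the counts add up to the
  \<open>i\<close>-th part of the conjugate of \<open>v\<close>; the \<open>Suc\<close> contributes
  the staircase entry \<open>K - i + 1\<close>.\<close>

definition tail_sum :: "nat \<Rightarrow> nat multiset \<Rightarrow> nat \<Rightarrow> nat" where
  "tail_sum K v i = (\<Sum>j = i..K. Suc (count v j))"

definition add_staircase :: "nat \<Rightarrow> nat multiset \<Rightarrow> nat multiset" where
  "add_staircase K v = image_mset (tail_sum K v) (mset_set {1..K})"

text \<open>The multiplicity of \<open>i\<close> is the excess over 1 of the difference of two
  neighbouring parts. At \<open>i = size p\<close> the next part is 0 by default, which leaves the
  smallest part minus 1.\<close>

definition gaps :: "nat multiset \<Rightarrow> nat multiset" where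
  "gaps p = (\<Sum>i = 1..size p. replicate_mset (part p i - part p (Suc i) - 1) i)"

lemma count_gaps:
  "count (gaps p) i = (if 1 \<le> i \<and> i \<le> size p then part p i - part p (Suc i) - 1 else 0)"
proof -
  have "count (gaps p) i = (\<Sum>j = 1..size p. if j = i then part p i - part p (Suc i) - 1 else 0)"
    unfolding gaps_def count_sum by (rule sum.cong) auto
  then show ?thesis by simp
qed

lemma tail_sum_rec: "i \<le> K \<Longrightarrow> tail_sum K v i = Suc (count v i) + tail_sum K v (Suc i)"
  by (simp add: tail_sum_def sum.atLeast_Suc_atMost)

lemma tail_sum_less: "i < j \<Longrightarrow> i \<le> K \<Longrightarrow> tail_sum K v j < tail_sum K v i"
proof (induction rule: less_Suc_induct)
  case (1 i)
  then show ?case using tail_sum_rec[of i K v] by simp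
next
  case (2 i j k)
  have "tail_sum K v k \<le> tail_sum K v j"
    unfolding tail_sum_def using 2 by (intro sum_mono2) auto
  with 2 show ?case by simp
qed

lemma part_add_staircase:
  "part (add_staircase K v) i = (if 1 \<le> i \<and> i \<le> K then tail_sum K v i else 0)"
  unfolding add_staircase_def
proof (rule part_image_mset_upto)
  show "tail_sum K v j \<le> tail_sum K v i" if "i \<le> j" "j \<le> K" for i j
    using tail_sum_less[of i j K v] that by (cases "i = j") auto
qed

lemma size_add_staircase [simp]: "size (add_staircase K v) = K"
  by (simp add: add_staircase_def)

lemma inj_tail_sum: "inj_on (tail_sum K v) {1..K}"
proof (rule inj_onI)
  fix i j assume "i \<in> {1..K}" "j \<in> {1..K}" "tail_sum K v i = tail_sum K v j"
  then show "i = j"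
    using tail_sum_less[of i j K v] tail_sum_less[of j i K v]
    by (cases i j rule: linorder_cases) auto
qed

lemma distinct_add_staircase: "distinct_parts (add_staircase K v)"
  unfolding add_staircase_def image_mset_mset_set[OF inj_tail_sum] distinct_parts_def
  by (simp add: count_mset_set')

lemma zero_notin_add_staircase: "0 \<notin># add_staircase K v"
  using tail_sum_rec[of _ K v] by (force simp: add_staircase_def)

lemma sum_add_staircase:
  assumes "set_mset v \<subseteq> {1..K}"
  shows "sum_mset (add_staircase K v) = sum_mset v + \<Sum>{1..K}"
proof -
  have "sum_mset (add_staircase K v) = (\<Sum>i = 1..K. \<Sum>j = i..K. Suc (count v j))"
    by (simp add: add_staircase_def flip: tail_sum_def sum_unfold_sum_mset)
  also have "\<dots> = (\<Sum>j = 1..K. j + j * count v j)"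
    unfolding sum_tails by simp
  finally show ?thesis
    by (simp add: sum_mset_conv_count[OF assms] sum.distrib)
qed

lemma gaps_add_staircase:
  assumes "set_mset v \<subseteq> {1..K}"
  shows "gaps (add_staircase K v) = v"
proof (rule multiset_eqI)
  fix i
  show "count (gaps (add_staircase K v)) i = count v i"
  proof (cases "1 \<le> i \<and> i \<le> K")
    case True
    moreover have "tail_sum K v (Suc K) = 0" by (simp add: tail_sum_def)
    ultimately show ?thesis
      using tail_sum_rec[of i K v] by (auto simp: count_gaps part_add_staircase not_less_eq_eq le_antisym)
  next
    case False
    then show ?thesis
      using assms by (auto simp: count_gaps not_in_iff[symmetric])
  qed
qed

lemma set_gaps: "set_mset (gaps p) \<subseteq> {1..size p}"
  by (auto simp: count_gaps simp flip: count_greater_zero_iff split: if_splits)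

text \<open>Downward induction telescopes the differences of parts. Distinctness, and positivity at
  the last index, keep the subtraction of 1 in \<open>gaps\<close> from truncating.\<close>

lemma add_staircase_gaps:
  assumes "distinct_parts p" "0 \<notin># p"
  shows "add_staircase (size p) (gaps p) = p"
proof -
  have "tail_sum (size p) (gaps p) i = part p i" if "1 \<le> i" "i \<le> Suc (size p)" for i
    using that(2,1)
  proof (induction rule: inc_induct)
    case base
    then show ?case by (simp add: tail_sum_def part_eq_0)
  next
    case (step i)
    have "part p (Suc i) < part p i"
      using part_strict[OF assms(1), of i "Suc i"] part_pos[OF assms(2), of i] step
      by (cases "i = size p") (auto simp: part_eq_0)
    then show ?case
      using step tail_sum_rec[of i "size p" "gaps p"] by (simp add: count_gaps)
  qed
  then have "add_staircase (size p) (gaps p) = image_mset (part p) (mset_set {1..size p})"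
    unfolding add_staircase_def by (intro image_mset_cong) auto
  then show ?thesis by (simp only: image_mset_part)
qed

text \<open>Neighbouring parts differ by \<open>Suc (count v i)\<close>, so below position
  \<open>K\<close> a sequence ends at \<open>i\<close> exactly if \<open>i\<close> is a part of
  \<open>v\<close>. The last sequence always ends at \<open>K\<close>.\<close>

lemma sequences_add_staircase:
  assumes "set_mset v \<subseteq> {1..K}" "K > 0"
  shows "card {R \<in> sequences (add_staircase K v). odd (card R)} = parity_changes (insert K (set_mset v))"
proof (rule card_odd_sequences[where f = "tail_sum K v"])
  fix i
  show "tail_sum K v (Suc i) + 1 < tail_sum K v i" if "i \<in> insert K (set_mset v)" "i < K"
    using that tail_sum_rec[of i K v] by (auto simp: count_greater_zero_iff[symmetric] simp del: count_greater_zero_iff)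
  show "tail_sum K v i = tail_sum K v (Suc i) + 1" if "i \<in> {1..K} - insert K (set_mset v)"
    using that tail_sum_rec[of i K v] by (auto simp: not_in_iff)
qed (use assms in \<open>auto simp: add_staircase_def\<close>)

lemma D_eq_card:
  assumes "K > 0"
  shows "D n K m = card {v. set_mset v \<subseteq> {1..K} \<and> sum_mset v + \<Sum>{1..K} = n
    \<and> parity_changes (insert K (set_mset v)) = m}" (is "_ = card ?Y")
proof -
  let ?X = "{p \<in> partitions n. distinct_parts p \<and> size p = K \<and> card {R \<in> sequences p. odd (card R)} = m}"
  have "gaps p \<in> ?Y \<and> add_staircase K (gaps p) = p" if "p \<in> ?X" for p
  proof -
    have "add_staircase K (gaps p) = p"
      using that add_staircase_gaps[of p] by (auto simp: partitions_def)
    moreover have "set_mset (gaps p) \<subseteq> {1..K}"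
      using set_gaps[of p] that by simp
    ultimately show ?thesis
      using sum_add_staircase[of "gaps p" K] sequences_add_staircase[of "gaps p" K] that assms
      by (auto simp: partitions_def)
  qed
  moreover have "add_staircase K v \<in> ?X \<and> gaps (add_staircase K v) = v" if "v \<in> ?Y" for v
    using that assms
    by (auto simp: partitions_def gaps_add_staircase sequences_add_staircase sum_add_staircase
        distinct_add_staircase zero_notin_add_staircase)
  ultimately have "bij_betw gaps ?X ?Y"
    by (intro bij_betw_byWitness[where f' = "add_staircase K"]) blast+
  then show ?thesis unfolding D_def by (rule bij_betw_same_card)
qed

section \<open>Partitions into odd parts\<close>

text \<open>The set under \<open>Max\<close> is an initial segment, as parts fall while
  \<open>2 * i - 1\<close> grows. Hence only membership of \<open>h\<close> and non-membership of
  \<open>Suc h\<close> need testing.\<close>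

lemma Dur2_eq_iff:
  assumes "p \<noteq> {#}" "0 \<notin># p" "h > 0"
  shows "Dur2 p = h \<longleftrightarrow> 2 * h - 1 \<le> part p h \<and> part p (Suc h) < 2 * h + 1"
proof -
  let ?S = "{i. 1 \<le> i \<and> 2 * i - 1 \<le> part p i}"
  have fin: "finite ?S"
  proof (rule finite_subset)
    show "?S \<subseteq> {..size p}"
      using part_eq_0[of p] by (force simp: not_le[symmetric])
  qed simp
  have "1 \<in> ?S"
    using part_pos[OF assms(2), of 1] assms(1) by (simp add: Suc_le_eq nonempty_has_size)
  have down: "i \<in> ?S" if "j \<in> ?S" "1 \<le> i" "i \<le> j" for i j
    using part_antimono[of i j p] that by auto
  have "Dur2 p = h \<longleftrightarrow> h \<in> ?S \<and> (\<forall>j\<in>?S. j \<le> h)"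
    using assms(1) \<open>1 \<in> ?S\<close> unfolding Dur2_def
    by (metis (no_types, lifting) Max_eq_iff empty_iff fin)
  also have "(\<forall>j\<in>?S. j \<le> h) \<longleftrightarrow> Suc h \<notin> ?S"
    using down[of _ "Suc h"] by (metis (no_types, lifting) Suc_n_not_le_n le_add1 not_less_eq_eq plus_1_eq_Suc)
  finally show ?thesis using assms(3) by auto
qed

section \<open>Conjugation and multiplicities in \<alpha>*\<close>

text \<open>Both sides say that the cell in row \<open>i\<close> and column \<open>j\<close> belongs
  to the diagram with rows \<open>a\<close>: the rows reaching column \<open>j\<close> form an
  initial segment.\<close>

lemma conjugate_le_iff:
  fixes a :: "nat \<Rightarrow> nat"
  assumes "\<And>i j. 1 \<le> i \<Longrightarrow> i \<le> j \<Longrightarrow> a j \<le> a i" "\<And>i. h < i \<Longrightarrow> a i = 0"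
    and "1 \<le> i" "1 \<le> j"
  shows "i \<le> card {i \<in> {1..h}. j \<le> a i} \<longleftrightarrow> j \<le> a i"
proof
  assume "j \<le> a i"
  then have "{1..i} \<subseteq> {i \<in> {1..h}. j \<le> a i}"
    using assms(1)[of _ i] assms(2)[of i] \<open>1 \<le> j\<close> by (fastforce simp: not_le[symmetric])
  then show "i \<le> card {i \<in> {1..h}. j \<le> a i}"
    using card_mono[of "{i \<in> {1..h}. j \<le> a i}" "{1..i}"] by simp
next
  assume le: "i \<le> card {i \<in> {1..h}. j \<le> a i}"
  show "j \<le> a i"
  proof (rule ccontr)
    assume "\<not> j \<le> a i"
    then have "{i \<in> {1..h}. j \<le> a i} \<subseteq> {1..<i}"
      using assms(1)[of i] \<open>1 \<le> i\<close> by (fastforce simp: not_le[symmetric])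
    then have "card {i \<in> {1..h}. j \<le> a i} \<le> i - 1"
      using card_mono[of "{1..<i}"] by fastforce
    with le \<open>1 \<le> i\<close> show False by simp
  qed
qed

lemma card_conjugate_eq:
  fixes a :: "nat \<Rightarrow> nat"
  assumes "\<And>i j. 1 \<le> i \<Longrightarrow> i \<le> j \<Longrightarrow> a j \<le> a i" "\<And>i. h < i \<Longrightarrow> a i = 0" and "1 \<le> i"
  shows "{j. 1 \<le> j \<and> card {i \<in> {1..h}. j \<le> a i} = i} = {a (Suc i)<..a i}"
proof -
  have "card {i \<in> {1..h}. j \<le> a i} = i \<longleftrightarrow> j \<le> a i \<and> \<not> j \<le> a (Suc i)" if "1 \<le> j" for j
  proof -
    have "i \<le> card {i \<in> {1..h}. j \<le> a i} \<longleftrightarrow> j \<le> a i"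
      "Suc i \<le> card {i \<in> {1..h}. j \<le> a i} \<longleftrightarrow> j \<le> a (Suc i)"
      by (rule conjugate_le_iff; use assms that in simp)+
    then show ?thesis by linarith
  qed
  then have "j \<in> {j. 1 \<le> j \<and> card {i \<in> {1..h}. j \<le> a i} = i} \<longleftrightarrow> j \<in> {a (Suc i)<..a i}" for j
    by (cases "1 \<le> j") (simp_all add: not_le conj_commute)
  then show ?thesis by blast
qed

lemma count_image_mset_set:
  assumes "finite A"
  shows "count (image_mset f (mset_set A)) b = card {a \<in> A. f a = b}"
proof -
  have "f -` {b} \<inter> A = {a \<in> A. f a = b}" by auto
  then show ?thesis using assms by (simp add: count_image_mset)
qed

lemma in_mset_set_imp: "x \<in># mset_set A \<Longrightarrow> x \<in> A"
  by (cases "finite A") auto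

text \<open>Here \<open>a\<close> lists the halved parts of \<alpha>, the row lengths of its
  2-modular diagram. Columns of length \<open>i\<close> are those reaching row \<open>i\<close> but
  not row \<open>Suc i\<close>.\<close>

lemma count_alpha_star:
  assumes a: "\<And>i. 1 \<le> i \<Longrightarrow> i \<le> Dur2 p \<Longrightarrow> alpha p i = 2 * a i" "\<And>i. Dur2 p < i \<Longrightarrow> a i = 0"
    and i: "1 \<le> i"
  shows "count (alpha_star p) (2 * i) = a i - a (Suc i)"
proof -
  have "alpha p j \<le> alpha p i" if "1 \<le> i" "i \<le> j" for i j
    using part_antimono[OF that, of p] by (simp add: alpha_def)
  then have anti: "a j \<le> a i" if "1 \<le> i" "i \<le> j" for i j
    using that a(1)[of i] a(1)[of j] a(2)[of j] by (cases "j \<le> Dur2 p") fastforce+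
  have asp: "alpha_star_part p j = 2 * card {i \<in> {1..Dur2 p}. j \<le> a i}" for j
    unfolding alpha_star_part_def using a(1) by (intro arg_cong[of _ _ "\<lambda>A. 2 * card A"]) auto
  \<comment> \<open>\<open>mset_set\<close> of an infinite set is empty, so finiteness must come
    before counting.\<close>
  have "finite {j. 1 \<le> j \<and> alpha_star_part p j \<noteq> 0}"
  proof (rule finite_subset)
    show "{j. 1 \<le> j \<and> alpha_star_part p j \<noteq> 0} \<subseteq> {..a 1}"
    proof
      fix j assume "j \<in> {j. 1 \<le> j \<and> alpha_star_part p j \<noteq> 0}"
      then obtain i where "i \<in> {1..Dur2 p}" "j \<le> a i"
        unfolding asp by (auto simp: card_gt_0_iff)
      then show "j \<in> {..a 1}" using anti[of 1 i] by auto
    qed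
  qed simp
  then have "count (alpha_star p) (2 * i) = card {j \<in> {j. 1 \<le> j \<and> alpha_star_part p j \<noteq> 0}. alpha_star_part p j = 2 * i}"
    unfolding alpha_star_def by (rule count_image_mset_set)
  also have "{j \<in> {j. 1 \<le> j \<and> alpha_star_part p j \<noteq> 0}. alpha_star_part p j = 2 * i}
      = {j. 1 \<le> j \<and> card {i \<in> {1..Dur2 p}. j \<le> a i} = i}"
    unfolding asp using i by (intro Collect_cong) (unfold mem_Collect_eq, linarith)
  also have "\<dots> = {a (Suc i)<..a i}"
    by (rule card_conjugate_eq) (use anti a(2) i in auto)
  finally show ?thesis by simp
qed

lemma alpha_star_even: "x \<in># alpha_star p \<Longrightarrow> even x \<and> 0 < x \<and> x \<le> 2 * Dur2 p"
proof -
  assume "x \<in># alpha_star p"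
  then obtain j where j: "alpha_star_part p j \<noteq> 0" "x = alpha_star_part p j"
    by (auto simp: alpha_star_def dest!: in_mset_set_imp)
  have "card {i \<in> {1..Dur2 p}. 2 * j \<le> alpha p i} \<le> card {1..Dur2 p}"
    by (rule card_mono) auto
  then have "alpha_star_part p j \<le> 2 * Dur2 p" by (simp add: alpha_star_part_def)
  moreover have "even (alpha_star_part p j)" by (simp add: alpha_star_part_def)
  ultimately show ?thesis using j by simp
qed

section \<open>The map to \<eta> and its inverse\<close>

definition eta_mset :: "nat multiset \<Rightarrow> nat multiset" where
  "eta_mset p = alpha_star p + beta p"

text \<open>This undoes the conjugation: for parts at most \<open>2 * h\<close> it counts the even
  parts from \<open>2 * i\<close> on, which is half of the \<open>i\<close>-th part of
  \<alpha>.\<close>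

definition even_tail :: "nat \<Rightarrow> nat multiset \<Rightarrow> nat \<Rightarrow> nat" where
  "even_tail h v i = (\<Sum>j = i..h. count v (2 * j))"

definition from_eta :: "nat \<Rightarrow> nat multiset \<Rightarrow> nat multiset" where
  "from_eta h v = image_mset (\<lambda>i. 2 * h - 1 + 2 * even_tail h v i) (mset_set {1..h}) + filter_mset odd v"

lemma even_tail_rec: "i \<le> h \<Longrightarrow> even_tail h v i = count v (2 * i) + even_tail h v (Suc i)"
  by (simp add: even_tail_def sum.atLeast_Suc_atMost)

lemma image_mset_upto_split:
  fixes h L :: nat
  assumes "h \<le> L"
  shows "image_mset f (mset_set {1..L}) = image_mset f (mset_set {1..h}) + image_mset f (mset_set {h + 1..L})"
proof -
  have "{1..L} = {1..h} \<union> {h + 1..L}" using assms by auto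
  then have "mset_set {1..L} = mset_set {1..h} + mset_set {h + 1..L}"
    by (simp add: mset_set_Union)
  then show ?thesis by simp
qed

lemma Dur2_bounds:
  assumes "0 \<notin># p" "p \<noteq> {#}" "Dur2 p = h" "h > 0"
  shows "2 * h - 1 \<le> part p h" "part p (Suc h) < 2 * h + 1" "h \<le> size p"
proof -
  show *: "2 * h - 1 \<le> part p h" "part p (Suc h) < 2 * h + 1"
    using Dur2_eq_iff[OF assms(2,1,4)] assms(3) by auto
  show "h \<le> size p"
    using * part_eq_0[of p h] assms(4) by (cases "h \<le> size p") auto
qed

lemma beta_odd:
  assumes "0 \<notin># p" "p \<noteq> {#}" "odd_parts p" "Dur2 p > 0" "x \<in># beta p"
  shows "odd x \<and> x \<le> 2 * Dur2 p - 1"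
proof -
  from assms(5) obtain i where i: "i \<in> {Dur2 p + 1..size p}" "x = part p i"
    by (auto simp: beta_def)
  then have "odd x"
    using assms(3) part_in[of i p] by (auto simp: odd_parts_def)
  moreover have "x < 2 * Dur2 p + 1"
    using i part_antimono[of "Suc (Dur2 p)" i p] Dur2_bounds[OF assms(1,2) refl assms(4)] by auto
  ultimately show ?thesis
    by (cases "x = 2 * Dur2 p") auto
qed

text \<open>Parity separates the two constituents of \<eta>: all parts of \<alpha>* are even and all
  parts of \<beta> are odd, so each can be recovered.\<close>

lemma eta_mset_props:
  assumes p: "0 \<notin># p" "p \<noteq> {#}" "odd_parts p" and h: "Dur2 p = h" "h > 0"
  shows "set_mset (eta_mset p) \<subseteq> {1..2 * h}"
    and "from_eta h (eta_mset p) = p"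
    and "eta_last p = (if 2 * h \<in># eta_mset p then 2 * h else 2 * h - 1)"
proof -
  note beta = beta_odd[OF p, unfolded h(1), OF h(2)]
  note star = alpha_star_even[of _ p, unfolded h(1)]
  show "set_mset (eta_mset p) \<subseteq> {1..2 * h}"
    using beta star by (force simp: eta_mset_def Suc_le_eq odd_pos)
  define a where "a i = (if i \<le> h then (part p i - (2 * h - 1)) div 2 else 0)" for i
  have part: "part p i = 2 * h - 1 + 2 * a i" if "1 \<le> i" "i \<le> h" for i
  proof -
    have "2 * h - 1 \<le> part p i" "i \<le> size p"
      using part_antimono[of i h p] Dur2_bounds[OF p(1,2) h] that by auto
    moreover have "odd (part p i)"
      using p(3) part_in[of i p] calculation that by (auto simp: odd_parts_def)
    ultimately show ?thesis using that h(2) by (simp add: a_def)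
  qed
  have star_count: "count (alpha_star p) (2 * i) = a i - a (Suc i)" if "1 \<le> i" for i
    using that by (intro count_alpha_star) (auto simp: alpha_def part h(1), simp add: a_def)
  have beta_count: "count (beta p) (2 * i) = 0" for i
    using beta[of "2 * i"] by (auto simp: not_in_iff[symmetric])
  have count: "count (eta_mset p) (2 * i) = a i - a (Suc i)" if "1 \<le> i" for i
    using star_count[OF that] beta_count by (simp add: eta_mset_def)
  have anti: "a (Suc i) \<le> a i" if "1 \<le> i" "i \<le> h" for i
    using part[of i] part[of "Suc i"] that part_antimono[of i "Suc i" p]
    by (cases "Suc i \<le> h") (auto simp: a_def intro!: div_le_mono)
  \<comment> \<open>The multiplicities \<open>a i - a (Suc i)\<close> telescope, starting from
    \<open>a (Suc h) = 0\<close>.\<close>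
  have "even_tail h (eta_mset p) i = a i" if "1 \<le> i" "i \<le> Suc h" for i
    using that(2,1)
  proof (induction rule: inc_induct)
    case base
    then show ?case by (simp add: even_tail_def a_def)
  next
    case (step i)
    then show ?case
      using even_tail_rec[of i h "eta_mset p"] anti[of i] count[of i] by simp
  qed
  then have "image_mset (\<lambda>i. 2 * h - 1 + 2 * even_tail h (eta_mset p) i) (mset_set {1..h})
      = image_mset (part p) (mset_set {1..h})"
    using part by (intro image_mset_cong) auto
  moreover have "filter_mset odd (alpha_star p) = {#}" "filter_mset odd (beta p) = beta p"
    using beta star by (auto intro!: multiset_eqI simp: not_in_iff[symmetric])
  then have "filter_mset odd (eta_mset p) = image_mset (part p) (mset_set {h + 1..size p})"
    by (simp add: eta_mset_def) (simp add: beta_def h(1))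
  ultimately have "from_eta h (eta_mset p) = image_mset (part p) (mset_set {1..size p})"
    using image_mset_upto_split[OF Dur2_bounds(3)[OF p(1,2) h], of "part p"] by (simp add: from_eta_def)
  then show "from_eta h (eta_mset p) = p"
    by (simp only: image_mset_part)
  \<comment> \<open>The part \<open>2 * h\<close> has multiplicity \<open>a h\<close>, since
    \<open>a (Suc h)\<close> is 0; this turns the case distinction of \<open>eta_last\<close> into
    one on \<eta>.\<close>
  have "2 * h \<in># eta_mset p \<longleftrightarrow> a h > 0"
    using count[of h] h(2) by (simp add: count_greater_zero_iff[symmetric] a_def del: count_greater_zero_iff)
  also have "\<dots> \<longleftrightarrow> part p h > 2 * h - 1"
    using part[of h] h(2) by auto
  finally show "eta_last p = (if 2 * h \<in># eta_mset p then 2 * h else 2 * h - 1)"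
    by (simp add: eta_last_def h(1))
qed

lemma sum_mset_split_parity:
  assumes "set_mset v \<subseteq> {1..2 * h}"
  shows "sum_mset v = (\<Sum>j = 1..h. 2 * (j * count v (2 * j))) + sum_mset (filter_mset odd v)"
  using assms
proof (induction v)
  case (add x v)
  show ?case
  proof (cases "odd x")
    case True
    then have "count (add_mset x v) (2 * j) = count v (2 * j)" for j by auto
    then show ?thesis using add True by simp
  next
    case False
    then obtain y where y: "x = 2 * y" by blast
    have "(\<Sum>j = 1..h. 2 * (j * count (add_mset x v) (2 * j)))
        = (\<Sum>j = 1..h. (if j = y then x else 0) + 2 * (j * count v (2 * j)))"
      by (rule sum.cong) (auto simp: y)
    also have "\<dots> = x + (\<Sum>j = 1..h. 2 * (j * count v (2 * j)))"
      using add.prems y by (simp add: sum.distrib)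
    finally show ?thesis using add False by simp
  qed
qed simp

lemma from_eta_props:
  assumes v: "set_mset v \<subseteq> {1..2 * h}" and h: "h > 0"
  shows "0 \<notin># from_eta h v" "from_eta h v \<noteq> {#}" "odd_parts (from_eta h v)"
    and "Dur2 (from_eta h v) = h"
    and "eta_mset (from_eta h v) = v"
    and "sum_mset (from_eta h v) = sum_mset v + h * (2 * h - 1)"
proof -
  let ?p = "from_eta h v"
  define ov where "ov = filter_mset odd v"
  define L where "L = h + size ov"
  \<comment> \<open>The parts in nonincreasing order: the first \<open>h\<close> are at least
    \<open>2 * h - 1\<close>, and the odd parts of \<open>v\<close>, being at most
    \<open>2 * h\<close>, do not exceed this bound.\<close>
  define f where "f i = (if i \<le> h then 2 * h - 1 + 2 * even_tail h v i else part ov (i - h))" for i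
  have "0 \<notin># v" using v by auto
  then show z: "0 \<notin># ?p" using h by (auto simp: from_eta_def)
  show ne: "?p \<noteq> {#}" using h by (auto simp: from_eta_def mset_set_empty_iff)
  show "odd_parts ?p" using h by (auto simp: from_eta_def odd_parts_def)
  have shift: "mset_set {h + 1..L} = image_mset ((+) h) (mset_set {1..size ov})"
    by (subst image_mset_mset_set) (auto simp: L_def image_add_atLeastAtMost)
  have "image_mset f (mset_set {h + 1..L}) = image_mset (part ov) (mset_set {1..size ov})"
    unfolding shift multiset.map_comp by (rule image_mset_cong) (auto simp: f_def)
  then have upper: "image_mset f (mset_set {h + 1..L}) = ov"
    by (simp only: image_mset_part)
  have "image_mset f (mset_set {1..h}) = image_mset (\<lambda>i. 2 * h - 1 + 2 * even_tail h v i) (mset_set {1..h})"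
    by (rule image_mset_cong) (auto simp: f_def)
  then have pf: "?p = image_mset f (mset_set {1..L})"
    using image_mset_upto_split[of h L f] upper by (simp add: L_def from_eta_def ov_def)
  have ov_le: "part ov i \<le> 2 * h - 1" for i
  proof (cases "1 \<le> i \<and> i \<le> size ov")
    case True
    then have "odd (part ov i)" "part ov i \<le> 2 * h"
      using part_in[of i ov] v by (auto simp: ov_def)
    then show ?thesis by (cases "part ov i = 2 * h") auto
  qed (auto simp: part_def)
  have anti: "f j \<le> f i" if "1 \<le> i" "i \<le> j" for i j
  proof -
    have "even_tail h v j \<le> even_tail h v i"
      unfolding even_tail_def using that by (intro sum_mono2) auto
    moreover have "part ov (j - h) \<le> part ov (i - h)" if "h < i"
      using that \<open>i \<le> j\<close> by (intro part_antimono) auto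
    ultimately show ?thesis
      using that ov_le[of "j - h"] by (auto simp: f_def intro: trans_le_add1)
  qed
  have part: "part ?p i = (if 1 \<le> i \<and> i \<le> L then f i else 0)" for i
    unfolding pf by (rule part_image_mset_upto) (use anti in auto)
  have hL: "h \<le> L" by (simp add: L_def)
  \<comment> \<open>Position \<open>Suc h\<close> holds the largest odd part of \<open>v\<close>, or
    the default 0 if there is none.\<close>
  have "part ?p h = f h" "part ?p (Suc h) \<le> 2 * h - 1"
    using part[of h] part[of "Suc h"] h hL ov_le[of 1] by (auto simp: f_def)
  then show dur: "Dur2 ?p = h"
    unfolding Dur2_eq_iff[OF ne z h] using h by (auto simp: f_def)
  have "alpha ?p i = 2 * even_tail h v i" if "1 \<le> i" "i \<le> h" for i
    using part[of i] that hL by (simp add: alpha_def dur f_def)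
  then have star: "count (alpha_star ?p) (2 * i) = even_tail h v i - even_tail h v (Suc i)" if "1 \<le> i" for i
    using that by (intro count_alpha_star) (auto simp: dur, simp add: even_tail_def)
  have "size ?p = L" by (simp add: pf)
  then have "beta ?p = image_mset f (mset_set {h + 1..L})"
    unfolding beta_def dur by (intro multiset.map_cong) (auto simp: part)
  then have beta: "beta ?p = ov" using upper by simp
  show "eta_mset ?p = v"
  proof (rule multiset_eqI)
    fix x
    show "count (eta_mset ?p) x = count v x"
    proof (cases "odd x")
      case True
      then have "count (alpha_star ?p) x = 0"
        using alpha_star_even[of x ?p] by (auto simp: not_in_iff[symmetric])
      then show ?thesis using True by (simp add: eta_mset_def beta ov_def)
    next
      case False
      then obtain i where i: "x = 2 * i" by blast
      have "count (alpha_star ?p) x = count v x"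
      proof (cases "1 \<le> i \<and> i \<le> h")
        case True
        then show ?thesis using star[of i] even_tail_rec[of i h v] by (simp add: i)
      next
        case False
        then have "x \<notin># alpha_star ?p" "x \<notin># v"
          using alpha_star_even[of x ?p] v by (auto simp: dur i)
        then show ?thesis by (simp add: not_in_iff)
      qed
      then show ?thesis using False by (simp add: eta_mset_def beta ov_def)
    qed
  qed
  have "sum_mset ?p = (\<Sum>i = 1..h. 2 * h - 1 + 2 * even_tail h v i) + sum_mset ov"
    by (simp only: from_eta_def ov_def sum_unfold_sum_mset sum_mset.union)
  also have "(\<Sum>i = 1..h. 2 * h - 1 + 2 * even_tail h v i) = h * (2 * h - 1) + 2 * (\<Sum>i = 1..h. even_tail h v i)"
    by (simp only: sum.distrib sum_distrib_left sum_constant card_atLeastAtMost) simp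
  also have "(\<Sum>i = 1..h. even_tail h v i) = (\<Sum>j = 1..h. j * count v (2 * j))"
    unfolding even_tail_def by (rule sum_tails)
  finally show "sum_mset ?p = sum_mset v + h * (2 * h - 1)"
    using sum_mset_split_parity[OF v] by (simp add: ov_def sum_distrib_left)
qed

section \<open>The alternating index as a count of parity changes\<close>

definition eta_top :: "nat \<Rightarrow> nat multiset \<Rightarrow> nat" where
  "eta_top h v = (if 2 * h \<in># v then 2 * h else 2 * h - 1)"

text \<open>The appended entry is at least as large as every part of \<eta>, so the list stays
  sorted. It is even exactly if \<open>2 * h\<close> is a part.\<close>

lemma alt_eq_parity_changes:
  assumes p: "0 \<notin># p" "p \<noteq> {#}" "odd_parts p" and h: "Dur2 p = h" "h > 0"
  shows "alt p = parity_changes (insert (eta_top h (eta_mset p)) (set_mset (eta_mset p)))"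
    and "even (alt p) \<longleftrightarrow> 2 * h \<in># eta_mset p"
proof -
  let ?l = "sorted_list_of_multiset (eta_mset p) @ [eta_top h (eta_mset p)]"
  have "x \<le> eta_top h (eta_mset p)" if "x \<in># eta_mset p" for x
    using eta_mset_props(1)[OF p h] that by (cases "x = 2 * h") (fastforce simp: eta_top_def)+
  then have "sorted ?l" by (simp add: sorted_append)
  moreover have "alt p = list_changes (0 # ?l)"
    using p(2) eta_mset_props(3)[OF p h]
    by (simp add: alt_def list_changes_def eta_def eta_mset_def eta_top_def)
  ultimately show "alt p = parity_changes (insert (eta_top h (eta_mset p)) (set_mset (eta_mset p)))"
    "even (alt p) \<longleftrightarrow> 2 * h \<in># eta_mset p"
    using list_changes_sorted[of ?l] even_list_changes[of ?l] h(2) by (auto simp: eta_top_def)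
qed

text \<open>The condition on the parity of \<open>m\<close> records whether \<open>2 * h\<close>
  occurs, which is how the two cases of the final comparison differ.\<close>

lemma B_eq_card:
  assumes "n > 0" "h > 0"
  shows "B n h m = card {v. set_mset v \<subseteq> {1..2 * h} \<and> sum_mset v + h * (2 * h - 1) = n
    \<and> (even m \<longleftrightarrow> 2 * h \<in># v) \<and> parity_changes (insert (eta_top h v) (set_mset v)) = m}" (is "_ = card ?Y")
proof -
  let ?X = "{p \<in> partitions n. odd_parts p \<and> Dur2 p = h \<and> alt p = m}"
  have "eta_mset p \<in> ?Y \<and> from_eta h (eta_mset p) = p" if "p \<in> ?X" for p
  proof -
    have p: "0 \<notin># p" "p \<noteq> {#}" "odd_parts p" "Dur2 p = h"
      using that assms(1) by (auto simp: partitions_def)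
    show ?thesis
      using eta_mset_props[OF p assms(2)] alt_eq_parity_changes[OF p assms(2)] that
        from_eta_props(6)[OF eta_mset_props(1)[OF p assms(2)] assms(2)]
      by (auto simp: partitions_def)
  qed
  moreover have "from_eta h v \<in> ?X \<and> eta_mset (from_eta h v) = v" if "v \<in> ?Y" for v
  proof -
    have v: "set_mset v \<subseteq> {1..2 * h}" using that by simp
    show ?thesis
      using that from_eta_props[OF v assms(2)] alt_eq_parity_changes(1)[OF from_eta_props(1-4)[OF v assms(2)] assms(2)]
      by (auto simp: partitions_def)
  qed
  ultimately have "bij_betw eta_mset ?X ?Y"
    by (intro bij_betw_byWitness[where f' = "from_eta h"]) blast+
  then show ?thesis unfolding B_def by (rule bij_betw_same_card)
qed

section \<open>Comparison of the two counts\<close>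

theorem theorem1p3:
  fixes n k m :: nat
  assumes "n > 0" and "k > 0"
    and "even k \<longleftrightarrow> even m"
  shows "B n (nat \<lceil>real k / 2\<rceil>) m = D n k m"
proof (cases "even k")
  case True
  then obtain h where k: "k = 2 * h" by blast
  let ?Y = "{v. set_mset v \<subseteq> {1..2 * h} \<and> sum_mset v + h * (2 * h - 1) = n
    \<and> (even m \<longleftrightarrow> 2 * h \<in># v) \<and> parity_changes (insert (eta_top h v) (set_mset v)) = m}"
  let ?Z = "{v. set_mset v \<subseteq> {1..2 * h} \<and> sum_mset v + \<Sum>{1..2 * h} = n
    \<and> parity_changes (insert (2 * h) (set_mset v)) = m}"
  have h: "h > 0" "even m" using assms k by auto
  \<comment> \<open>The surplus \<open>2 * h\<close> of the staircase is the weight of the one part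
    that is removed from \<open>v\<close>.\<close>
  have stair: "\<Sum>{1..2 * h} = h * (2 * h - 1) + 2 * h"
    using h(1) by (cases h) (simp_all add: Sum_Icc_nat algebra_simps)
  have "bij_betw (add_mset (2 * h)) ?Z ?Y"
  proof (rule bij_betw_byWitness[where f' = "\<lambda>v. v - {#2 * h#}"])
    show "(\<lambda>v. v - {#2 * h#}) ` ?Y \<subseteq> ?Z"
    proof (rule image_subsetI)
      fix v assume v: "v \<in> ?Y"
      \<comment> \<open>As \<open>m\<close> is even, \<open>2 * h\<close> is a part of
        \<open>v\<close>. Removing one copy does not affect the parity changes, where
        \<open>2 * h\<close> is inserted anyway.\<close>
      with h(2) obtain w where "v = add_mset (2 * h) w" by (auto dest: multi_member_split)
      then show "v - {#2 * h#} \<in> ?Z"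
        using v stair by (simp add: eta_top_def)
    qed
    show "add_mset (2 * h) ` ?Z \<subseteq> ?Y"
      using h stair by (intro image_subsetI) (simp add: eta_top_def)
  qed (use h in auto)
  then have "card ?Z = card ?Y" by (rule bij_betw_same_card)
  moreover have "nat \<lceil>real k / 2\<rceil> = h" by (simp add: k)
  ultimately show ?thesis
    using B_eq_card[OF assms(1) h(1), of m] D_eq_card[OF assms(2), of n m] k by simp
next
  case False
  then obtain i where i: "k = 2 * i + 1" by (elim oddE)
  define h where "h = Suc i"
  have k: "k = 2 * h - 1" "h > 0" using i by (simp_all add: h_def)
  have "\<lceil>real k / 2\<rceil> = int h"
    using k by (intro ceiling_unique) auto
  then have ceil: "nat \<lceil>real k / 2\<rceil> = h" by simp
  have stair: "\<Sum>{1..k} = h * (2 * h - 1)"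
    by (simp add: i h_def Sum_Icc_nat algebra_simps)
  have "{1..2 * h} - {2 * h} = {1..k}" using k by auto
  then have top: "set_mset v \<subseteq> {1..k} \<longleftrightarrow> set_mset v \<subseteq> {1..2 * h} \<and> 2 * h \<notin># v" for v
    by (metis Diff_empty subset_Diff_insert)
  \<comment> \<open>For odd \<open>m\<close> the part \<open>2 * h\<close> is absent, so
    \<open>eta_top h v\<close> is \<open>k\<close>, and the staircase has weight
    \<open>h * (2 * h - 1)\<close>: the two sets coincide.\<close>
  have "{v. set_mset v \<subseteq> {1..2 * h} \<and> sum_mset v + h * (2 * h - 1) = n
    \<and> (even m \<longleftrightarrow> 2 * h \<in># v) \<and> parity_changes (insert (eta_top h v) (set_mset v)) = m}
    = {v. set_mset v \<subseteq> {1..k} \<and> sum_mset v + \<Sum>{1..k} = n \<and> parity_changes (insert k (set_mset v)) = m}"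
  proof (rule Collect_cong)
    fix v
    have "even m \<longleftrightarrow> False" using False assms(3) by simp
    then show "set_mset v \<subseteq> {1..2 * h} \<and> sum_mset v + h * (2 * h - 1) = n
      \<and> (even m \<longleftrightarrow> 2 * h \<in># v) \<and> parity_changes (insert (eta_top h v) (set_mset v)) = m
      \<longleftrightarrow> set_mset v \<subseteq> {1..k} \<and> sum_mset v + \<Sum>{1..k} = n \<and> parity_changes (insert k (set_mset v)) = m"
      unfolding stair top eta_top_def by (cases "2 * h \<in># v") (simp_all add: k(1))
  qed
  then show ?thesis
    using B_eq_card[OF assms(1) k(2), of m] D_eq_card[OF assms(2), of n m] ceil by simp
qed

end
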